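(* Let $\Omega\subset\mathbb{R}^n$ and let $f:\Omega\to\mathbb{R}$ be a convex function on $\Omega$. Suppose that at least one of the following holds: (1) $f$ is bounded below; (2) $\Omega$ contains a point in the relative interior of the convex hull $\Omega^{\mathrm{co}}$. Then $f$ can be extended to a convex function $\hat f:\Omega^{\mathrm{co}}\to\mathbb{R}$ on the convex hull of $\Omega$.
   Context: All functions are real valued and never take the values $\pm\infty$. The set $\Omega$ is not assumed convex. A function $f:\Omega\to\mathbb{R}$, $\Omega\subset\mathbb{R}^n$, is called convex if $f(x)\le \lambda_1 f(x_1)+\cdots+\lambda_k f(x_k)$ whenever $x_1,\dots,x_k\in\Omega$, $\lambda_i\ge 0$, $\lambda_1+\cdots+\lambda_k=1$, and the convex combination $x=\lambda_1x_1+\cdots+\lambda_kx_k$ also lies in $\Omega$. $\Omega^{\mathrm{co}}$ denotes the convex hull of $\Omega$, and relative interior means interior relative to the affine hull. *)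

theory Defs
  imports "HOL-Analysis.Analysis"
begin

text \<open>
  Convexity of a function on a set that need not be convex. The library's \<open>convex_on\<close>
  is not suitable here: it requires its domain to be a convex set, and it only looks at convex
  combinations of two points, which is not enough when the intermediate points may lie outside
  the set.
\<close>

definition convex_fun_on :: "'a::real_vector set \<Rightarrow> ('a \<Rightarrow> real) \<Rightarrow> bool" where
  "convex_fun_on \<Omega> f \<longleftrightarrow>
     (\<forall>(k::nat) (x :: nat \<Rightarrow> 'a) (u :: nat \<Rightarrow> real).
        (\<forall>i\<in>{1..k}. x i \<in> \<Omega> \<and> 0 \<le> u i) \<longrightarrow>
        (\<Sum>i=1..k. u i) = 1 \<longrightarrow>
        (\<Sum>i=1..k. u i *\<^sub>R x i) \<in> \<Omega> \<longrightarrow>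
        f (\<Sum>i=1..k. u i *\<^sub>R x i) \<le> (\<Sum>i=1..k. u i * f (x i)))"

text \<open>On a convex set this is the usual notion.\<close>

lemma convex_fun_on_iff_convex_on:
  assumes "convex S"
  shows "convex_fun_on S f \<longleftrightarrow> convex_on S f"
proof
  assume f: "convex_fun_on S f"
  show "convex_on S f"
    unfolding convex_on_def
  proof (intro conjI ballI allI impI assms)
    fix x y :: 'a and u v :: real
    assume *: "x \<in> S" "y \<in> S" "0 \<le> u" "0 \<le> v" "u + v = 1"
    let ?x = "\<lambda>i::nat. if i = 1 then x else y" and ?l = "\<lambda>i::nat. if i = 1 then u else v"
    have "u *\<^sub>R x + v *\<^sub>R y \<in> S" using assms * by (simp add: convexD)
    then show "f (u *\<^sub>R x + v *\<^sub>R y) \<le> u * f x + v * f y"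
      using f[unfolded convex_fun_on_def, rule_format, of 2 ?x ?l] * by (simp add: numeral_2_eq_2)
  qed
next
  assume "convex_on S f"
  then show "convex_fun_on S f"
    unfolding convex_fun_on_def
  proof (intro allI impI)
    fix k and x :: "nat \<Rightarrow> 'a" and l :: "nat \<Rightarrow> real"
    assume f: "convex_on S f" and *: "\<forall>i\<in>{1..k}. x i \<in> S \<and> 0 \<le> l i" "(\<Sum>i=1..k. l i) = 1"
    then have "{1..k} \<noteq> {}" by force
    then show "f (\<Sum>i=1..k. l i *\<^sub>R x i) \<le> (\<Sum>i=1..k. l i * f (x i))"
      using f * by (intro convex_on_sum[of _ S]) auto
  qed
qed

end

theory Submission
  imports Defs
begin

text \<open>
  The extension is the lower boundary of the convex hull of the graph of \<open>f\<close>. Convexity of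
  \<open>f\<close> says that this hull has no points below the graph over \<open>\<Omega>\<close>; what has to be excluded is
  that some vertical fibre is unbounded below. If \<open>p \<in> \<Omega>\<close> is relatively interior, every
  segment from \<open>x\<close> to \<open>p\<close> can be prolonged inside the hull, so an arbitrarily low
  point over \<open>x\<close> would yield a point over \<open>p\<close> lying below \<open>f p\<close>.
\<close>

text \<open>The weights that express \<open>(p, r)\<close> through points of the graph average their
  first coordinates to \<open>p\<close> and the values of \<open>f\<close> there to
  \<open>r\<close>, so the defining inequality applies.\<close>

lemma convex_fun_on_le_convex_hull_graph:
  assumes f: "convex_fun_on S f" and pr: "(p, r) \<in> convex hull ((\<lambda>x. (x, f x)) ` S)" and p: "p \<in> S"
  shows "f p \<le> r"
proof -
  from pr obtain k :: nat and u z where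
    z: "\<forall>i\<in>{1..k}. 0 \<le> u i \<and> z i \<in> (\<lambda>x. (x, f x)) ` S"
    and u: "sum u {1..k} = 1" and eq: "(\<Sum>i=1..k. u i *\<^sub>R z i) = (p, r)"
    unfolding convex_hull_indexed by blast
  have snd_z: "snd (z i) = f (fst (z i))" if "i \<in> {1..k}" for i
    using z that by force
  have p_eq: "p = (\<Sum>i=1..k. u i *\<^sub>R fst (z i))"
    using arg_cong[OF eq, of fst] by (simp add: fst_sum)
  have r_eq: "r = (\<Sum>i=1..k. u i * f (fst (z i)))"
    using arg_cong[OF eq, of snd] by (simp add: snd_sum snd_z)
  have "\<forall>i\<in>{1..k}. fst (z i) \<in> S \<and> 0 \<le> u i"
    using z by force
  then show ?thesis
    using f[unfolded convex_fun_on_def, rule_format, of k "\<lambda>i. fst (z i)" u] u p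
    unfolding p_eq r_eq by blast
qed

text \<open>Nearly lowest points over \<open>x\<close> and \<open>y\<close> combine inside
  \<open>E\<close>. The slack \<open>e\<close> is needed because the infima may not be attained; it
  survives unchanged since the weights sum to 1.\<close>

lemma convex_on_Inf_fibre:
  fixes E :: "('a::real_vector \<times> real) set"
  assumes E: "convex E" and bdd: "\<And>x. x \<in> fst ` E \<Longrightarrow> bdd_below {t. (x, t) \<in> E}"
  shows "convex_on (fst ` E) (\<lambda>x. Inf {t. (x, t) \<in> E})"
proof -
  let ?g = "\<lambda>x. Inf {t. (x, t) \<in> E}"
  have conv: "convex (fst ` E)"
    by (rule convex_linear_image[OF linear_fst E])
  moreover have "?g (u *\<^sub>R x + v *\<^sub>R y) \<le> u * ?g x + v * ?g y"
    if x: "x \<in> fst ` E" and y: "y \<in> fst ` E" and uv: "0 \<le> u" "0 \<le> v" "u + v = 1" for x y u v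
  proof (rule field_le_epsilon)
    fix e :: real assume "0 < e"
    have near: "\<exists>t. (w, t) \<in> E \<and> t < ?g w + e" if "w \<in> fst ` E" for w
      using that bdd[OF that] \<open>0 < e\<close> cInf_less_iff[of "{t. (w, t) \<in> E}" "?g w + e"] by force
    obtain s t where s: "(x, s) \<in> E" "s < ?g x + e" and t: "(y, t) \<in> E" "t < ?g y + e"
      using near[OF x] near[OF y] by blast
    have "u *\<^sub>R (x, s) + v *\<^sub>R (y, t) \<in> E"
      using E s(1) t(1) uv by (rule convexD)
    then have "?g (u *\<^sub>R x + v *\<^sub>R y) \<le> u * s + v * t"
      using x y uv convexD[OF conv] by (intro cInf_lower bdd) auto
    also have "\<dots> \<le> u * (?g x + e) + v * (?g y + e)"
      using s t uv by (intro add_mono mult_left_mono) auto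
    also have "\<dots> = u * ?g x + v * ?g y + (u + v) * e"
      by (simp add: algebra_simps)
    finally show "?g (u *\<^sub>R x + v *\<^sub>R y) \<le> u * ?g x + v * ?g y + e"
      using uv by simp
  qed
  ultimately show ?thesis
    by (simp add: convex_on_def)
qed

lemma bdd_below_fibre_if_rel_interior:
  fixes E :: "('a::euclidean_space \<times> real) set"
  assumes E: "convex E" and p: "p \<in> rel_interior (fst ` E)"
    and bdd: "bdd_below {t. (p, t) \<in> E}" and x: "x \<in> fst ` E"
  shows "bdd_below {t. (x, t) \<in> E}"
proof -
  have conv: "convex (fst ` E)"
    by (rule convex_linear_image[OF linear_fst E])
  \<comment> \<open>Since \<open>e > 1\<close>, this point lies on the line from \<open>x\<close>
    through \<open>p\<close>, beyond \<open>p\<close>.\<close>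
  obtain e where e: "e > 1" "(1 - e) *\<^sub>R x + e *\<^sub>R p \<in> fst ` E"
    using convex_rel_interior_iff[OF conv] p x by blast
  then obtain s where s: "((1 - e) *\<^sub>R x + e *\<^sub>R p, s) \<in> E"
    by auto
  obtain m where m: "\<And>r. (p, r) \<in> E \<Longrightarrow> m \<le> r"
    using bdd by (auto simp: bdd_below_def)
  \<comment> \<open>The bound is \<open>m \<le> s / e + (1 - 1 / e) * t\<close> solved for
    \<open>t\<close>.\<close>
  have "(e * m - s) / (e - 1) \<le> t" if t: "(x, t) \<in> E" for t
  proof -
    \<comment> \<open>These weights undo the prolongation: the combination lies over
      \<open>p\<close>.\<close>
    have "(1 / e) *\<^sub>R ((1 - e) *\<^sub>R x + e *\<^sub>R p, s) + (1 - 1 / e) *\<^sub>R (x, t) \<in> E"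
      using e by (intro convexD[OF E s t]) auto
    moreover have "(1 / e) *\<^sub>R ((1 - e) *\<^sub>R x + e *\<^sub>R p) + (1 - 1 / e) *\<^sub>R x = p"
    proof -
      have "(1 / e) *\<^sub>R ((1 - e) *\<^sub>R x + e *\<^sub>R p) + (1 - 1 / e) *\<^sub>R x
          = ((1 - e) / e + (1 - 1 / e)) *\<^sub>R x + p"
        using e(1) by (simp add: scaleR_add_right scaleR_add_left)
      also have "(1 - e) / e + (1 - 1 / e) = 0"
        using e(1) by (simp add: field_simps)
      finally show ?thesis
        by simp
    qed
    ultimately have "m \<le> (1 / e) * s + (1 - 1 / e) * t"
      using m by simp
    then show ?thesis
      using e(1) by (simp add: field_simps)
  qed
  then show ?thesis
    by (intro bdd_belowI) auto
qed

theorem theorem3p1: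
  fixes \<Omega> :: "(real ^ 'n) set" and f :: "real ^ 'n \<Rightarrow> real"
  assumes "convex_fun_on \<Omega> f"
    and "bdd_below (f ` \<Omega>) \<or> \<Omega> \<inter> rel_interior (convex hull \<Omega>) \<noteq> {}"
  shows "\<exists>g :: real ^ 'n \<Rightarrow> real.
           convex_fun_on (convex hull \<Omega>) g \<and> (\<forall>x\<in>\<Omega>. g x = f x)"
proof -
  define E where "E = convex hull ((\<lambda>x. (x, f x)) ` \<Omega>)"
  have E: "convex E"
    by (simp add: E_def)
  have fst_E: "fst ` E = convex hull \<Omega>"
    by (simp add: E_def convex_hull_linear_image[OF linear_fst] image_image)
  have above: "f p \<le> r" if "p \<in> \<Omega>" "(p, r) \<in> E" for p r
    using convex_fun_on_le_convex_hull_graph assms(1) that E_def by blast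
  have graph: "(p, f p) \<in> E" if "p \<in> \<Omega>" for p
    using that by (auto simp: E_def intro: hull_inc)
  have bdd: "bdd_below {t. (x, t) \<in> E}" if x: "x \<in> fst ` E" for x
    using assms(2)
  proof
    assume "bdd_below (f ` \<Omega>)"
    then obtain m where "\<And>x. x \<in> \<Omega> \<Longrightarrow> m \<le> f x"
      by (auto simp: bdd_below_def)
    \<comment> \<open>A half-space is convex, so containing the graph it contains the hull.\<close>
    then have "E \<subseteq> UNIV \<times> {m..}"
      unfolding E_def by (intro hull_minimal convex_Times) auto
    then show ?thesis
      by (intro bdd_belowI[of _ m]) auto
  next
    assume "\<Omega> \<inter> rel_interior (convex hull \<Omega>) \<noteq> {}"
    then obtain p where "p \<in> \<Omega>" "p \<in> rel_interior (fst ` E)"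
      by (auto simp: fst_E)
    \<comment> \<open>Here \<open>p \<in> \<Omega>\<close> matters: convexity of \<open>f\<close>
      controls the hull only over \<Omega>.\<close>
    moreover from this have "bdd_below {t. (p, t) \<in> E}"
      using above by (intro bdd_belowI[of _ "f p"]) auto
    ultimately show ?thesis
      using bdd_below_fibre_if_rel_interior[OF E _ _ x] by simp
  qed
  have "convex_fun_on (convex hull \<Omega>) (\<lambda>x. Inf {t. (x, t) \<in> E})"
    using convex_on_Inf_fibre[OF E bdd] by (simp add: fst_E convex_fun_on_iff_convex_on)
  \<comment> \<open>Over \<Omega> the infimum is attained, at the graph point itself.\<close>
  moreover have "Inf {t. (x, t) \<in> E} = f x" if "x \<in> \<Omega>" for x
    using above graph that by (intro cInf_eq_minimum) auto
  ultimately show ?thesis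
    by blast
qed

end
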